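(* Assume that $M,N\colon G\to\mathbb C$ satisfy $\beta(M)\ge\beta(N)$ and $\Psi_M\Psi_{N,N}\ne0$. (i) Assume that $\Psi_N\Psi_{M,N}=\Psi_M\Psi_{N,N}$. Then for all $\alpha\in\mathbb C$ with $\alpha\ne-\frac{\Psi_M}{\Psi_N}$ we have $\beta(M+\alpha N)=\beta(M)$. (ii) Assume that $\Psi_N\Psi_{M,N}\neq\Psi_M\Psi_{N,N}$. Then, for $\alpha\in\mathbb C$, the maximum of $\beta(M+\alpha N)$ occurs for $$\alpha=\alpha_1:=\frac{\overline{\Psi_M}\Psi_{M,N}-\overline{\Psi_N}\Psi_{M,M}}{\overline{\Psi_N}\,\overline{\Psi_{M,N}}-\overline{\Psi_M}\Psi_{N,N}}$$ and is $$\beta(M+\alpha_1N)=\frac{|\Psi_N|^2\Psi_{M,M}+|\Psi_M|^2\Psi_{N,N}-2\mathrm{Re}(\overline{\Psi_M}\Psi_N\Psi_{M,N})}{\Psi_{M,M}\Psi_{N,N}-|\Psi_{M,N}|^2}=\beta(M)+\frac{|\overline{\Psi_M}\Psi_{M,N}-\overline{\Psi_N}\Psi_{M,M}|^2}{\Psi_{M,M}(\Psi_{M,M}\Psi_{N,N}-|\Psi_{M,N}|^2)}.$$ The denominators in these expressions for $\beta(M+\alpha_1N)$ are positive.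
   Context: $G$ is an (indexing) set, $L\colon G\to\mathbb C$ is a function, and $w\colon G\to[0,\infty)$ is a weight function, not identically $0$. For $f\colon G\to\mathbb C$ put $\mathbb E^w_{\pi\in G}f(\pi):=\frac{\sum_{\pi\in G}w(\pi)f(\pi)}{\sum_{\pi\in G}w(\pi)}$. For $M,N\colon G\to\mathbb C$ define $\Psi_M:=\mathbb E^w_{\pi\in G}L(\pi)M(\pi)$, $\Psi_{M,N}:=\mathbb E^w_{\pi\in G}L(\pi)M(\pi)\overline{L(\pi)N(\pi)}$, and $\beta(M):=|\Psi_M|^2/\Psi_{M,M}$ if $\Psi_{M,M}\ne0$, $\beta(M):=0$ if $\Psi_{M,M}=0$. It is assumed that the series $\sum_\pi w(\pi)$ and $\sum_\pi w(\pi)|L(\pi)M(\pi)|^2$ converge for every function $M$ considered (automatic if $G$ is finite). (In (i), the hypotheses force $\Psi_N\neq0$.) *)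

theory Defs
  imports "HOL-Analysis.Infinite_Sum"
begin

definition wmean :: "'g set \<Rightarrow> ('g \<Rightarrow> real) \<Rightarrow> ('g \<Rightarrow> complex) \<Rightarrow> complex" where
  "wmean G w f =
     (\<Sum>\<^sub>\<infinity>\<pi>\<in>G. complex_of_real (w \<pi>) * f \<pi>) / complex_of_real (\<Sum>\<^sub>\<infinity>\<pi>\<in>G. w \<pi>)"

definition Psi :: "'g set \<Rightarrow> ('g \<Rightarrow> real) \<Rightarrow> ('g \<Rightarrow> complex) \<Rightarrow> ('g \<Rightarrow> complex) \<Rightarrow> complex" where
  "Psi G w L M = wmean G w (\<lambda>\<pi>. L \<pi> * M \<pi>)"

definition Psi2 ::
  "'g set \<Rightarrow> ('g \<Rightarrow> real) \<Rightarrow> ('g \<Rightarrow> complex) \<Rightarrow> ('g \<Rightarrow> complex) \<Rightarrow> ('g \<Rightarrow> complex) \<Rightarrow> complex" where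
  "Psi2 G w L M N = wmean G w (\<lambda>\<pi>. L \<pi> * M \<pi> * cnj (L \<pi> * N \<pi>))"

text \<open>The diagonal values of \<open>Psi2\<close> are real, so passing to \<open>Re (Psi2 G w L M M)\<close>
  below loses no information.\<close>

lemma Psi2_self_real: "Psi2 G w L M M \<in> \<real>"
proof -
  have "cnj (Psi2 G w L M M) = Psi2 G w L M M"
    by (simp add: Psi2_def wmean_def mult_ac flip: infsum_cnj)
  then show ?thesis
    by (simp add: Reals_cnj_iff)
qed

lemma of_real_Re_Psi2_self: "complex_of_real (Re (Psi2 G w L M M)) = Psi2 G w L M M"
  using Psi2_self_real of_real_Re by blast

definition beta :: "'g set \<Rightarrow> ('g \<Rightarrow> real) \<Rightarrow> ('g \<Rightarrow> complex) \<Rightarrow> ('g \<Rightarrow> complex) \<Rightarrow> real" where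
  "beta G w L M =
     (if Psi2 G w L M M = 0 then 0 else (cmod (Psi G w L M))\<^sup>2 / Re (Psi2 G w L M M))"

end

theory Submission
  imports Defs
begin

text \<open>
  Write \<open>m\<close>, \<open>n\<close> for the linear values of \<open>M\<close>, \<open>N\<close> and \<open>A\<close>, \<open>B\<close>, \<open>C\<close> for the values of the
  Hermitian form, and put \<open>D = A C - |B|\<^sup>2\<close>, \<open>u = n B - m C\<close>, \<open>z = C \<alpha> + B\<close>. Completing the square
  gives \<open>C Q(\<alpha>) = |z|\<^sup>2 + D\<close> for the quadratic form \<open>Q(\<alpha>)\<close> of \<open>M + \<alpha> N\<close>, while
  \<open>C (m + \<alpha> n) = n z - u\<close>. Hence, if \<open>D > 0\<close>, the Cauchy-Schwarz inequality bounds
  \<open>|m + \<alpha> n|\<^sup>2 / Q(\<alpha>)\<close> by \<open>(|n|\<^sup>2 D + |u|\<^sup>2) / (C D)\<close>, with equality iff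
  \<open>n D + u cnj z = 0\<close>, that is \<open>\<alpha> = \<alpha>\<^sub>1\<close>. If \<open>D = 0\<close>, then \<open>M + \<alpha> N\<close> has vanishing quadratic form
  for \<open>\<alpha> = - B / C\<close>, hence vanishing linear value, so \<open>u = 0\<close>; (ii) excludes this. In (i), \<open>u = 0\<close>
  together with \<open>\<beta>(M) \<ge> \<beta>(N)\<close> forces \<open>D = 0\<close>, and then
  \<open>Q(\<alpha>) = C |m + \<alpha> n|\<^sup>2 / |n|\<^sup>2\<close>.
\<close>

section \<open>Weighted means and convergence of the series\<close>

lemma wmean_add:
  assumes "(\<lambda>\<pi>. complex_of_real (w \<pi>) * f \<pi>) summable_on G"
    and "(\<lambda>\<pi>. complex_of_real (w \<pi>) * g \<pi>) summable_on G"
  shows "wmean G w (\<lambda>\<pi>. f \<pi> + g \<pi>) = wmean G w f + wmean G w g"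
  using infsum_add[OF assms] by (simp add: wmean_def distrib_left add_divide_distrib)

text \<open>True for divergent sums as well, whose value is 0 by convention: a factor
  \<open>c \<noteq> 0\<close> neither creates nor destroys summability, and \<open>c = 0\<close>
  gives 0 on both sides.\<close>

lemma wmean_cmult: "wmean G w (\<lambda>\<pi>. c * f \<pi>) = c * wmean G w f"
  by (simp add: wmean_def mult.left_commute infsum_cmult_right')

lemma wmean_cnj: "wmean G w (\<lambda>\<pi>. cnj (f \<pi>)) = cnj (wmean G w f)"
  by (simp add: wmean_def flip: infsum_cnj)

lemma Psi2_cnj: "cnj (Psi2 G w L M N) = Psi2 G w L N M"
  by (simp add: Psi2_def mult_ac flip: wmean_cnj)

lemma weighted_summable_product:
  fixes f g :: "'g \<Rightarrow> complex"
  assumes w: "\<And>\<pi>. \<pi> \<in> G \<Longrightarrow> 0 \<le> w \<pi>"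
    and f: "(\<lambda>\<pi>. w \<pi> * (cmod (f \<pi>))\<^sup>2) summable_on G"
    and g: "(\<lambda>\<pi>. w \<pi> * (cmod (g \<pi>))\<^sup>2) summable_on G"
  shows "(\<lambda>\<pi>. complex_of_real (w \<pi>) * (f \<pi> * cnj (g \<pi>))) summable_on G"
proof -
  have "(\<lambda>\<pi>. norm (complex_of_real (w \<pi>) * (f \<pi> * cnj (g \<pi>)))) summable_on G"
  proof (rule summable_on_comparison_test)
    show "(\<lambda>\<pi>. w \<pi> * (cmod (f \<pi>))\<^sup>2 + w \<pi> * (cmod (g \<pi>))\<^sup>2) summable_on G"
      by (rule summable_on_add[OF f g])
    show "norm (complex_of_real (w \<pi>) * (f \<pi> * cnj (g \<pi>)))
        \<le> w \<pi> * (cmod (f \<pi>))\<^sup>2 + w \<pi> * (cmod (g \<pi>))\<^sup>2" if "\<pi> \<in> G" for \<pi>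
    proof -
      \<comment> \<open>The inequality \<open>2 x y \<le> x\<^sup>2 + y\<^sup>2\<close> supplies the
        majorant; its factor 2 is then dropped.\<close>
      have "2 * (cmod (f \<pi>) * cmod (g \<pi>)) \<le> (cmod (f \<pi>))\<^sup>2 + (cmod (g \<pi>))\<^sup>2"
        using sum_squares_bound[of "cmod (f \<pi>)" "cmod (g \<pi>)"] by simp
      moreover have "0 \<le> cmod (f \<pi>) * cmod (g \<pi>)"
        by simp
      ultimately have "cmod (f \<pi>) * cmod (g \<pi>) \<le> (cmod (f \<pi>))\<^sup>2 + (cmod (g \<pi>))\<^sup>2"
        by linarith
      from mult_left_mono[OF this w[OF that]] show ?thesis
        using w[OF that] by (simp add: norm_mult distrib_left)
    qed
  qed auto
  then show ?thesis
    by (rule abs_summable_summable)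
qed

lemma weighted_summable:
  fixes f :: "'g \<Rightarrow> complex"
  assumes "\<And>\<pi>. \<pi> \<in> G \<Longrightarrow> 0 \<le> w \<pi>" and "w summable_on G"
    and "(\<lambda>\<pi>. w \<pi> * (cmod (f \<pi>))\<^sup>2) summable_on G"
  shows "(\<lambda>\<pi>. complex_of_real (w \<pi>) * f \<pi>) summable_on G"
  \<comment> \<open>For the constant function 1, square summability is summability of
    \<open>w\<close> itself.\<close>
  using weighted_summable_product[of G w f "\<lambda>_. 1"] assms by simp

text \<open>Keeps \<open>M + \<alpha> N\<close> among the admissible functions, by
  \<open>|x + y|\<^sup>2 \<le> 2 |x|\<^sup>2 + 2 |y|\<^sup>2\<close>.\<close>

lemma weighted_summable_sq_add:
  fixes f g :: "'g \<Rightarrow> complex"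
  assumes w: "\<And>\<pi>. \<pi> \<in> G \<Longrightarrow> 0 \<le> w \<pi>"
    and f: "(\<lambda>\<pi>. w \<pi> * (cmod (f \<pi>))\<^sup>2) summable_on G"
    and g: "(\<lambda>\<pi>. w \<pi> * (cmod (g \<pi>))\<^sup>2) summable_on G"
  shows "(\<lambda>\<pi>. w \<pi> * (cmod (f \<pi> + c * g \<pi>))\<^sup>2) summable_on G"
proof (rule summable_on_comparison_test)
  show "(\<lambda>\<pi>. 2 * (w \<pi> * (cmod (f \<pi>))\<^sup>2) + 2 * (cmod c)\<^sup>2 * (w \<pi> * (cmod (g \<pi>))\<^sup>2)) summable_on G"
    by (intro summable_on_add summable_on_cmult_right f g)
  show "w \<pi> * (cmod (f \<pi> + c * g \<pi>))\<^sup>2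
      \<le> 2 * (w \<pi> * (cmod (f \<pi>))\<^sup>2) + 2 * (cmod c)\<^sup>2 * (w \<pi> * (cmod (g \<pi>))\<^sup>2)" if "\<pi> \<in> G" for \<pi>
  proof -
    have "(cmod (f \<pi> + c * g \<pi>))\<^sup>2 \<le> (cmod (f \<pi>) + cmod (c * g \<pi>))\<^sup>2"
      by (intro power_mono norm_triangle_ineq) simp
    also have "\<dots> \<le> 2 * (cmod (f \<pi>))\<^sup>2 + 2 * (cmod (c * g \<pi>))\<^sup>2"
      using sum_squares_bound[of "cmod (f \<pi>)" "cmod (c * g \<pi>)"] by (simp add: power2_sum)
    finally show ?thesis
      using mult_left_mono[OF _ w[OF that]]
      by (fastforce simp: norm_mult power_mult_distrib algebra_simps)
  qed
qed (use w in auto)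

section \<open>Expansion of the linear functional and the Hermitian form along M + \<alpha>
  N\<close>

lemma Psi_add_cmult:
  assumes "\<And>\<pi>. \<pi> \<in> G \<Longrightarrow> 0 \<le> w \<pi>" and "w summable_on G"
    and "(\<lambda>\<pi>. w \<pi> * (cmod (L \<pi> * M \<pi>))\<^sup>2) summable_on G"
    and "(\<lambda>\<pi>. w \<pi> * (cmod (L \<pi> * N \<pi>))\<^sup>2) summable_on G"
  shows "Psi G w L (\<lambda>\<pi>. M \<pi> + \<alpha> * N \<pi>) = Psi G w L M + \<alpha> * Psi G w L N"
proof -
  note sM = weighted_summable[OF assms(1,2,3)]
  note sN = summable_on_cmult_right[OF weighted_summable[OF assms(1,2,4)], of \<alpha>]
  have "Psi G w L (\<lambda>\<pi>. M \<pi> + \<alpha> * N \<pi>) = wmean G w (\<lambda>\<pi>. L \<pi> * M \<pi> + \<alpha> * (L \<pi> * N \<pi>))"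
    by (simp add: Psi_def algebra_simps)
  also have "\<dots> = Psi G w L M + \<alpha> * Psi G w L N"
    using sM sN by (subst wmean_add) (simp_all add: wmean_cmult Psi_def mult_ac)
  finally show ?thesis .
qed

lemma Psi2_add_cmult:
  assumes w: "\<And>\<pi>. \<pi> \<in> G \<Longrightarrow> 0 \<le> w \<pi>"
    and M: "(\<lambda>\<pi>. w \<pi> * (cmod (L \<pi> * M \<pi>))\<^sup>2) summable_on G"
    and N: "(\<lambda>\<pi>. w \<pi> * (cmod (L \<pi> * N \<pi>))\<^sup>2) summable_on G"
    and K: "(\<lambda>\<pi>. w \<pi> * (cmod (L \<pi> * K \<pi>))\<^sup>2) summable_on G"
  shows "Psi2 G w L (\<lambda>\<pi>. M \<pi> + \<alpha> * N \<pi>) K = Psi2 G w L M K + \<alpha> * Psi2 G w L N K"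
proof -
  note sM = weighted_summable_product[OF w M K]
  note sN = summable_on_cmult_right[OF weighted_summable_product[OF w N K], of \<alpha>]
  have "Psi2 G w L (\<lambda>\<pi>. M \<pi> + \<alpha> * N \<pi>) K
      = wmean G w (\<lambda>\<pi>. L \<pi> * M \<pi> * cnj (L \<pi> * K \<pi>) + \<alpha> * (L \<pi> * N \<pi> * cnj (L \<pi> * K \<pi>)))"
    by (simp add: Psi2_def algebra_simps)
  also have "\<dots> = Psi2 G w L M K + \<alpha> * Psi2 G w L N K"
    using sM sN by (subst wmean_add) (simp_all add: wmean_cmult Psi2_def mult_ac)
  finally show ?thesis .
qed

lemma Psi2_self_add_cmult:
  assumes w: "\<And>\<pi>. \<pi> \<in> G \<Longrightarrow> 0 \<le> w \<pi>"
    and M: "(\<lambda>\<pi>. w \<pi> * (cmod (L \<pi> * M \<pi>))\<^sup>2) summable_on G"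
    and N: "(\<lambda>\<pi>. w \<pi> * (cmod (L \<pi> * N \<pi>))\<^sup>2) summable_on G"
  shows "Psi2 G w L (\<lambda>\<pi>. M \<pi> + \<alpha> * N \<pi>) (\<lambda>\<pi>. M \<pi> + \<alpha> * N \<pi>)
    = Psi2 G w L M M + cnj \<alpha> * Psi2 G w L M N + \<alpha> * cnj (Psi2 G w L M N)
      + \<alpha> * cnj \<alpha> * Psi2 G w L N N"
proof -
  let ?X = "\<lambda>\<pi>. M \<pi> + \<alpha> * N \<pi>"
  have X: "(\<lambda>\<pi>. w \<pi> * (cmod (L \<pi> * ?X \<pi>))\<^sup>2) summable_on G"
    using weighted_summable_sq_add[OF w M N, of \<alpha>] by (simp add: algebra_simps)
  \<comment> \<open>Conjugate symmetry turns linearity in the first argument into antilinearity in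
    the second.\<close>
  have "Psi2 G w L K ?X = Psi2 G w L K M + cnj \<alpha> * Psi2 G w L K N"
    if "(\<lambda>\<pi>. w \<pi> * (cmod (L \<pi> * K \<pi>))\<^sup>2) summable_on G" for K
    using arg_cong[OF Psi2_add_cmult[OF w M N that], of cnj \<alpha>] by (simp add: Psi2_cnj)
  from this[OF M] this[OF N] show ?thesis
    by (simp add: Psi2_add_cmult[OF w M N X] Psi2_cnj algebra_simps)
qed

section \<open>Positivity and null vectors of the Hermitian form\<close>

lemma infsum_of_real_complex:
  "(\<Sum>\<^sub>\<infinity>x\<in>A. complex_of_real (f x)) = complex_of_real (\<Sum>\<^sub>\<infinity>x\<in>A. f x)"
  \<comment> \<open>Taking real parts shows that both families are summable or neither is; in the
    latter case both sums are 0 by convention.\<close>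
  by (rule infsum_bounded_linear_strong)
    (auto simp: bounded_linear_of_real intro: summable_on_of_real dest: summable_on_Re)

lemma Psi2_self_eq:
  "Psi2 G w L M M
    = complex_of_real ((\<Sum>\<^sub>\<infinity>\<pi>\<in>G. w \<pi> * (cmod (L \<pi> * M \<pi>))\<^sup>2) / (\<Sum>\<^sub>\<infinity>\<pi>\<in>G. w \<pi>))"
proof -
  have "complex_of_real (w \<pi>) * (L \<pi> * M \<pi> * cnj (L \<pi> * M \<pi>))
      = complex_of_real (w \<pi> * (cmod (L \<pi> * M \<pi>))\<^sup>2)" for \<pi>
    by (simp only: of_real_mult flip: complex_norm_square)
  then show ?thesis
    by (simp only: Psi2_def wmean_def infsum_of_real_complex of_real_divide)
qed

lemma Re_Psi2_self_nonneg:
  assumes "\<And>\<pi>. \<pi> \<in> G \<Longrightarrow> 0 \<le> w \<pi>"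
  shows "0 \<le> Re (Psi2 G w L M M)"
  using assms by (auto simp only: Psi2_self_eq Re_complex_of_real
      intro!: divide_nonneg_nonneg infsum_nonneg mult_nonneg_nonneg zero_le_power2)

text \<open>A vanishing sum of nonnegative terms vanishes termwise, so \<open>w L M = 0\<close> on
  \<open>G\<close>. This is the degenerate case of the Cauchy-Schwarz inequality.\<close>

lemma Psi_eq_0_if_Psi2_self_eq_0:
  assumes w: "\<And>\<pi>. \<pi> \<in> G \<Longrightarrow> 0 \<le> w \<pi>" and "w summable_on G"
    and M: "(\<lambda>\<pi>. w \<pi> * (cmod (L \<pi> * M \<pi>))\<^sup>2) summable_on G"
    and 0: "Psi2 G w L M M = 0"
  shows "Psi G w L M = 0"
\<comment> \<open>With total weight 0, division by zero makes every mean 0.\<close>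
proof (cases "(\<Sum>\<^sub>\<infinity>\<pi>\<in>G. w \<pi>) = 0")
  case True
  then show ?thesis
    by (simp add: Psi_def wmean_def)
next
  case False
  with 0 have *: "(\<Sum>\<^sub>\<infinity>\<pi>\<in>G. w \<pi> * (cmod (L \<pi> * M \<pi>))\<^sup>2) = 0"
    by (simp only: Psi2_self_eq of_real_eq_0_iff divide_eq_0_iff simp_thms)
  have "w \<pi> * (cmod (L \<pi> * M \<pi>))\<^sup>2 = 0" if "\<pi> \<in> G" for \<pi>
    by (rule nonneg_infsum_le_0D[OF _ M _ that]) (use * w in auto)
  then have "complex_of_real (w \<pi>) * (L \<pi> * M \<pi>) = 0" if "\<pi> \<in> G" for \<pi>
    using that by fastforce
  then have "(\<Sum>\<^sub>\<infinity>\<pi>\<in>G. complex_of_real (w \<pi>) * (L \<pi> * M \<pi>)) = 0"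
    by (intro infsum_0) auto
  then show ?thesis
    by (simp add: Psi_def wmean_def)
qed

section \<open>Two polynomial identities\<close>

lemma complete_the_square:
  fixes A C :: real and B \<alpha> :: complex
  shows "C * Re (A + cnj \<alpha> * B + \<alpha> * cnj B + \<alpha> * cnj \<alpha> * C)
    = (cmod (C * \<alpha> + B))\<^sup>2 + (A * C - (cmod B)\<^sup>2)"
  unfolding cmod_power2 by (simp add: power2_eq_square algebra_simps)

text \<open>For \<open>D \<ge> 0\<close> this is Lagrange's identity for the vectors
  \<open>(n sqrt D, u)\<close> and \<open>(cnj z, - sqrt D)\<close>; the right-hand side displays
  the case of equality.\<close>

lemma Cauchy_Schwarz_defect:
  fixes D :: real and n u z :: complex
  shows "((cmod n)\<^sup>2 * D + (cmod u)\<^sup>2) * ((cmod z)\<^sup>2 + D) - D * (cmod (n * z - u))\<^sup>2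
    = (cmod (n * D + u * cnj z))\<^sup>2"
  unfolding cmod_power2 by (simp add: power2_eq_square algebra_simps)

section \<open>Maximizing beta over M + \<alpha> N\<close>

theorem theorem2p5:
  fixes G :: "'g set" and w :: "'g \<Rightarrow> real" and L M N :: "'g \<Rightarrow> complex"
  assumes w_nonneg: "\<And>\<pi>. \<pi> \<in> G \<Longrightarrow> 0 \<le> w \<pi>"
    and w_nonzero: "\<exists>\<pi>\<in>G. w \<pi> \<noteq> 0"
    and w_summable: "w summable_on G"
    and M_summable: "(\<lambda>\<pi>. w \<pi> * (cmod (L \<pi> * M \<pi>))\<^sup>2) summable_on G"
    and N_summable: "(\<lambda>\<pi>. w \<pi> * (cmod (L \<pi> * N \<pi>))\<^sup>2) summable_on G"
    and beta_ge: "beta G w L M \<ge> beta G w L N"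
    and nonzero: "Psi G w L M * Psi2 G w L N N \<noteq> 0"
  shows
    "(Psi G w L N * Psi2 G w L M N = Psi G w L M * Psi2 G w L N N \<longrightarrow>
        (\<forall>\<alpha>::complex. \<alpha> \<noteq> - (Psi G w L M / Psi G w L N) \<longrightarrow>
           beta G w L (\<lambda>\<pi>. M \<pi> + \<alpha> * N \<pi>) = beta G w L M))
     \<and>
     (Psi G w L N * Psi2 G w L M N \<noteq> Psi G w L M * Psi2 G w L N N \<longrightarrow>
        (let \<alpha>\<^sub>1 = (cnj (Psi G w L M) * Psi2 G w L M N - cnj (Psi G w L N) * Psi2 G w L M M)
                   / (cnj (Psi G w L N) * cnj (Psi2 G w L M N)
                      - cnj (Psi G w L M) * Psi2 G w L N N);
             D = Re (Psi2 G w L M M) * Re (Psi2 G w L N N) - (cmod (Psi2 G w L M N))\<^sup>2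
         in (\<forall>\<alpha>::complex. beta G w L (\<lambda>\<pi>. M \<pi> + \<alpha> * N \<pi>)
                            \<le> beta G w L (\<lambda>\<pi>. M \<pi> + \<alpha>\<^sub>1 * N \<pi>))
            \<and> beta G w L (\<lambda>\<pi>. M \<pi> + \<alpha>\<^sub>1 * N \<pi>)
                = ((cmod (Psi G w L N))\<^sup>2 * Re (Psi2 G w L M M)
                   + (cmod (Psi G w L M))\<^sup>2 * Re (Psi2 G w L N N)
                   - 2 * Re (cnj (Psi G w L M) * Psi G w L N * Psi2 G w L M N)) / D
            \<and> beta G w L (\<lambda>\<pi>. M \<pi> + \<alpha>\<^sub>1 * N \<pi>)
                = beta G w L M
                  + (cmod (cnj (Psi G w L M) * Psi2 G w L M N
                           - cnj (Psi G w L N) * Psi2 G w L M M))\<^sup>2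
                    / (Re (Psi2 G w L M M) * D)
            \<and> 0 < D
            \<and> 0 < Re (Psi2 G w L M M) * D))"
proof -
  define m where "m = Psi G w L M"
  define n where "n = Psi G w L N"
  define B where "B = Psi2 G w L M N"
  define A where "A = Re (Psi2 G w L M M)"
  define C where "C = Re (Psi2 G w L N N)"
  define D where "D = A * C - (cmod B)\<^sup>2"
  define u where "u = n * B - m * C"
  define Q where "Q \<alpha> = Re (A + cnj \<alpha> * B + \<alpha> * cnj B + \<alpha> * cnj \<alpha> * C)" for \<alpha>
  define b where "b \<alpha> = beta G w L (\<lambda>\<pi>. M \<pi> + \<alpha> * N \<pi>)" for \<alpha>
  have PA: "Psi2 G w L M M = A" and PC: "Psi2 G w L N N = C"
    by (simp_all add: A_def C_def of_real_Re_Psi2_self)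
  have Psi2_Q: "Psi2 G w L (\<lambda>\<pi>. M \<pi> + \<alpha> * N \<pi>) (\<lambda>\<pi>. M \<pi> + \<alpha> * N \<pi>) = Q \<alpha>" for \<alpha>
    using of_real_Re_Psi2_self[of G w L "\<lambda>\<pi>. M \<pi> + \<alpha> * N \<pi>"]
    by (simp add: Psi2_self_add_cmult[OF w_nonneg M_summable N_summable] PA PC Q_def flip: B_def)
  have Psi_lin: "Psi G w L (\<lambda>\<pi>. M \<pi> + \<alpha> * N \<pi>) = m + \<alpha> * n" for \<alpha>
    unfolding m_def n_def
    by (rule Psi_add_cmult[OF w_nonneg w_summable M_summable N_summable])
  have Q_nonneg: "0 \<le> Q \<alpha>" for \<alpha>
    using Re_Psi2_self_nonneg[of G w L "\<lambda>\<pi>. M \<pi> + \<alpha> * N \<pi>", OF w_nonneg]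
    by (simp add: Psi2_Q)
  have Q_0: "m + \<alpha> * n = 0" if "Q \<alpha> = 0" for \<alpha>
  proof -
    have "(\<lambda>\<pi>. w \<pi> * (cmod (L \<pi> * (M \<pi> + \<alpha> * N \<pi>)))\<^sup>2) summable_on G"
      using weighted_summable_sq_add[OF w_nonneg M_summable N_summable, of \<alpha>]
      by (simp add: algebra_simps)
    from Psi_eq_0_if_Psi2_self_eq_0[OF w_nonneg w_summable this] that show ?thesis
      by (simp add: Psi2_Q Psi_lin)
  qed
  \<comment> \<open>At a zero of \<open>Q\<close>, division by zero yields the default value 0 of
    \<open>beta\<close>.\<close>
  have b_eq: "b \<alpha> = (cmod (m + \<alpha> * n))\<^sup>2 / Q \<alpha>" for \<alpha>
    by (simp add: b_def beta_def Psi2_Q Psi_lin)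
  have m: "m \<noteq> 0" and "C \<noteq> 0"
    using nonzero by (auto simp: m_def PC)
  moreover have "0 \<le> C" "0 \<le> A"
    unfolding A_def C_def by (intro Re_Psi2_self_nonneg w_nonneg; assumption)+
  \<comment> \<open>At \<open>\<alpha> = 0\<close>, a zero of \<open>Q\<close> would force
    \<open>m = 0\<close>.\<close>
  moreover have "A \<noteq> 0"
    using m Q_0[of 0] by (auto simp: Q_def)
  ultimately have C: "0 < C" and A: "0 < A"
    by auto
  have bM: "beta G w L M = (cmod m)\<^sup>2 / A" and bN: "beta G w L N = (cmod n)\<^sup>2 / C"
    using A C by (simp_all add: beta_def PA PC m_def n_def)
  have CQ: "C * Q \<alpha> = (cmod (C * \<alpha> + B))\<^sup>2 + D" for \<alpha> :: complex
    unfolding Q_def D_def by (rule complete_the_square)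
  have C_lin: "C * (m + \<alpha> * n) = n * (C * \<alpha> + B) - u" for \<alpha> :: complex
    by (simp add: u_def algebra_simps)
  \<comment> \<open>The point \<open>- (B / C)\<close> minimizes \<open>Q\<close>, so
    \<open>D \<ge> 0\<close> is the Cauchy-Schwarz inequality for the form.\<close>
  have CQ0: "C * Q (- (B / C)) = D"
    using CQ[of "- (B / C)"] C by simp
  have D_nonneg: "0 \<le> D"
    using CQ0 Q_nonneg[of "- (B / C)"] C by (metis mult_nonneg_nonneg less_imp_le)

  \<comment> \<open>Case (i): beta is constant away from one point\<close>
  have part1: "b \<alpha> = beta G w L M" if u0: "n * B = m * C" and \<alpha>: "\<alpha> \<noteq> - (m / n)" for \<alpha>
  proof -
    have n: "n \<noteq> 0"
      using u0 m C by auto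
    have nB: "(cmod n)\<^sup>2 * (cmod B)\<^sup>2 = (cmod m)\<^sup>2 * C\<^sup>2"
      using arg_cong[OF u0, of "\<lambda>x. (cmod x)\<^sup>2"] by (simp add: norm_mult power_mult_distrib)
    have le: "(cmod n)\<^sup>2 * A \<le> (cmod m)\<^sup>2 * C"
      using beta_ge A C by (simp add: bM bN field_simps)
    have nD: "(cmod n)\<^sup>2 * D = C * ((cmod n)\<^sup>2 * A - (cmod m)\<^sup>2 * C)"
      using nB by (simp add: D_def algebra_simps power2_eq_square)
    \<comment> \<open>The hypothesis \<open>beta_ge\<close>, in the form \<open>le\<close>, works
      against \<open>D \<ge> 0\<close> and leaves only \<open>D = 0\<close>.\<close>
    have "(cmod n)\<^sup>2 * D \<le> 0"
      unfolding nD using le C by (simp add: mult_le_0_iff)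
    with n D_nonneg have "D = 0"
      by (simp add: mult_le_0_iff)
    with nD C have eq: "(cmod n)\<^sup>2 * A = (cmod m)\<^sup>2 * C"
      by simp
    \<comment> \<open>The excluded \<open>\<alpha>\<close> is the zero of the linear value, where
      \<open>beta\<close> would drop to 0.\<close>
    have lin: "m + \<alpha> * n \<noteq> 0"
      using \<alpha> n by (auto simp: field_simps add_eq_0_iff)
    have "C * (m + \<alpha> * n) = n * (C * \<alpha> + B)"
      using C_lin[of \<alpha>] u0 by (simp add: u_def)
    from arg_cong[OF this, of "\<lambda>x. (cmod x)\<^sup>2"]
    have "C\<^sup>2 * (cmod (m + \<alpha> * n))\<^sup>2 = (cmod n)\<^sup>2 * (C * Q \<alpha>)"
      by (simp add: norm_mult power_mult_distrib CQ \<open>D = 0\<close>)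
    then have "C * (C * (cmod (m + \<alpha> * n))\<^sup>2) = C * ((cmod n)\<^sup>2 * Q \<alpha>)"
      by (simp only: power2_eq_square mult_ac)
    then have *: "C * (cmod (m + \<alpha> * n))\<^sup>2 = (cmod n)\<^sup>2 * Q \<alpha>"
      using C by simp
    have "Q \<alpha> \<noteq> 0"
      using Q_0 lin by blast
    with * C have "b \<alpha> = (cmod n)\<^sup>2 / C"
      by (simp add: b_eq field_simps)
    \<comment> \<open>With \<open>D = 0\<close>, the inequality \<open>le\<close> has become an
      equality, so \<open>beta\<close> takes the same value at \<open>N\<close> and
      \<open>M\<close>.\<close>
    also have "\<dots> = (cmod m)\<^sup>2 / A"
      using eq A C by (simp add: frac_eq_eq)
    finally show ?thesis
      by (simp add: bM)
  qed

  \<comment> \<open>Case (ii): a unique zero of the Cauchy-Schwarz defect\<close>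
  define K where "K = (cmod n)\<^sup>2 * A + (cmod m)\<^sup>2 * C - 2 * Re (cnj m * n * B)"
  \<comment> \<open>Up to conjugation, \<open>v\<close> is \<open>u\<close> with \<open>M\<close>
    and \<open>N\<close> exchanged; \<open>K / D\<close> will be the maximum.\<close>
  define v where "v = cnj m * B - cnj n * A"
  define \<alpha>\<^sub>1 where "\<alpha>\<^sub>1 = v / (cnj n * cnj B - cnj m * C)"
  have part2: "(\<forall>\<alpha>. b \<alpha> \<le> b \<alpha>\<^sub>1) \<and> b \<alpha>\<^sub>1 = K / D
      \<and> b \<alpha>\<^sub>1 = beta G w L M + (cmod v)\<^sup>2 / (A * D) \<and> 0 < D \<and> 0 < A * D"
    if "n * B \<noteq> m * C"
  proof -
    have u: "u \<noteq> 0"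
      using that by (simp add: u_def)
    have "D \<noteq> 0"
    proof
      assume "D = 0"
      then have "Q (- (B / C)) = 0"
        using CQ0 C by simp
      from C_lin[of "- (B / C)"] Q_0[OF this] u C show False
        by simp
    qed
    with D_nonneg have D: "0 < D"
      by simp
    have Q_pos: "0 < Q \<alpha>" for \<alpha>
    proof -
      have "0 < C * Q \<alpha>"
        using D by (simp add: CQ add_nonneg_pos)
      with C show ?thesis
        by (simp add: zero_less_mult_iff)
    qed
    have CK: "C * K = (cmod n)\<^sup>2 * D + (cmod u)\<^sup>2"
      unfolding K_def D_def u_def cmod_power2 by (simp add: power2_eq_square algebra_simps)
    \<comment> \<open>The factor \<open>C\<^sup>2\<close> lets \<open>C * Q \<alpha>\<close>,
      \<open>C * (m + \<alpha> * n)\<close> and \<open>C * K\<close> be replaced by their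
      expressions in \<open>C * \<alpha> + B\<close>, \<open>u\<close> and \<open>D\<close>.\<close>
    have defect: "C\<^sup>2 * (K * Q \<alpha> - D * (cmod (m + \<alpha> * n))\<^sup>2)
        = (cmod (n * D + u * cnj (C * \<alpha> + B)))\<^sup>2" for \<alpha> :: complex
    proof -
      have "C\<^sup>2 * (K * Q \<alpha> - D * (cmod (m + \<alpha> * n))\<^sup>2)
          = (C * K) * (C * Q \<alpha>) - D * (cmod (C * (m + \<alpha> * n)))\<^sup>2"
        unfolding norm_mult norm_of_real power_mult_distrib power2_abs
        by (simp add: power2_eq_square algebra_simps)
      also have "\<dots> = (cmod (n * D + u * cnj (C * \<alpha> + B)))\<^sup>2"
        unfolding C_lin CQ CK by (rule Cauchy_Schwarz_defect)
      finally show ?thesis .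
    qed
    have le: "b \<alpha> \<le> K / D" for \<alpha>
    proof -
      have "0 \<le> C\<^sup>2 * (K * Q \<alpha> - D * (cmod (m + \<alpha> * n))\<^sup>2)"
        by (simp only: defect zero_le_power2)
      then have "D * (cmod (m + \<alpha> * n))\<^sup>2 \<le> K * Q \<alpha>"
        using C by (simp add: zero_le_mult_iff)
      then show ?thesis
        using D Q_pos[of \<alpha>] by (simp add: b_eq field_simps)
    qed
    have "cnj n * cnj B - cnj m * C = cnj u"
      by (simp add: u_def)
    then have "\<alpha>\<^sub>1 * cnj u = v"
      using u by (simp add: \<alpha>\<^sub>1_def)
    \<comment> \<open>Multiplying \<open>C * \<alpha>\<^sub>1 + B\<close> by \<open>cnj u\<close>
      clears the denominator of \<open>\<alpha>\<^sub>1\<close>; the conjugate of the result is the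
      equality condition in \<open>defect\<close>.\<close>
    moreover have "C * v + B * cnj u = - cnj n * D"
      using complex_norm_square[of B] by (simp add: v_def u_def D_def algebra_simps)
    ultimately have "(C * \<alpha>\<^sub>1 + B) * cnj u = - cnj n * D"
      by (metis distrib_right mult.assoc)
    from arg_cong[OF this, of cnj] have "n * D + u * cnj (C * \<alpha>\<^sub>1 + B) = 0"
      by (simp add: algebra_simps)
    with defect[of \<alpha>\<^sub>1] C have "D * (cmod (m + \<alpha>\<^sub>1 * n))\<^sup>2 = K * Q \<alpha>\<^sub>1"
      by simp
    then have max: "b \<alpha>\<^sub>1 = K / D"
      using D Q_pos[of \<alpha>\<^sub>1] by (simp add: b_eq field_simps)
    \<comment> \<open>This is \<open>CK\<close> with \<open>M\<close> and \<open>N\<close>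
      exchanged, which preserves \<open>K\<close> and \<open>D\<close>.\<close>
    have "A * K = (cmod m)\<^sup>2 * D + (cmod v)\<^sup>2"
      unfolding K_def D_def v_def cmod_power2 by (simp add: power2_eq_square algebra_simps)
    then have "K / D = (cmod m)\<^sup>2 / A + (cmod v)\<^sup>2 / (A * D)"
      using A D by (simp add: field_simps)
    with le max A D show ?thesis
      by (simp add: bM)
  qed

  show ?thesis
    unfolding Let_def PA PC Re_complex_of_real
    unfolding m_def[symmetric] n_def[symmetric] B_def[symmetric] b_def[symmetric]
      D_def[symmetric] v_def[symmetric] K_def[symmetric] \<alpha>\<^sub>1_def[symmetric]
    using part1 part2 by blast
qed

end
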